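(* Let $(B_i)_{i\ge 0}$ be the sequence of finite binary words obtained from $B_0=00$ by iterating Kimberling's inflation rules $0\mapsto 0$, $1\mapsto 10$, $00\mapsto 0101$ (as described in the context). Let $c_0=2$, $c_1=4$, $c_2=6$, $c_3=10$, and define $c_i=2c_{i-1}-c_{i-4}$ for $i\ge 4$. Then $|B_i|=c_i$ for all $i\ge 0$, where $|B_i|$ denotes the length of $B_i$.
   Context: Definition of the words $B_i$ over $\{0,1\}$: $B_0=00$. Given $B_i$, factor it into blocks as follows: each letter $1$ is a block by itself, and each maximal run of consecutive $0$'s is a block, which is either $0$ (run of length 1) or $00$ (run of length 2) (runs of three or more $0$'s never occur). Then $B_{i+1}$ is obtained by replacing each block $0$ by $0$, each block $1$ by $10$, and each block $00$ by $0101$, and concatenating in order. For example $B_1=0101$, $B_2=010010$, $B_3=0100101100$, $B_4=010010110010100101$. *)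

theory Defs
  imports Main
begin

datatype letter = L0 | L1

type_synonym word = "letter list"

text \<open>Factorisation into blocks: a letter 1 stands alone, the letters 0 are grouped into
  maximal runs, of any length.\<close>

function blocks :: "word \<Rightarrow> word list" where
  "blocks [] = []"
| "blocks (L1 # w) = [L1] # blocks w"
| "blocks (L0 # w) =
     (L0 # takeWhile (\<lambda>x. x = L0) w) # blocks (dropWhile (\<lambda>x. x = L0) w)"
  by pat_completeness auto
termination
  by (relation "measure length") (auto simp: le_imp_less_Suc length_dropWhile_le)

text \<open>There is no rule for runs of three or more 0's; on such blocks the value is left
  unspecified. That they do not occur in the words \<open>B i\<close> is not assumed.\<close>

fun inflate_block :: "word \<Rightarrow> word" where
  "inflate_block [L0] = [L0]"
| "inflate_block [L1] = [L1, L0]"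
| "inflate_block [L0, L0] = [L0, L1, L0, L1]"
| "inflate_block _ = undefined"

definition inflate :: "word \<Rightarrow> word" where
  "inflate w = concat (map inflate_block (blocks w))"

primrec B :: "nat \<Rightarrow> word" where
  "B 0 = [L0, L0]"
| "B (Suc i) = inflate (B i)"

text \<open>Integer-valued, so that the subtraction in the recurrence does not truncate.\<close>

fun c :: "nat \<Rightarrow> int" where
  "c 0 = 2"
| "c (Suc 0) = 4"
| "c (Suc (Suc 0)) = 6"
| "c (Suc (Suc (Suc 0))) = 10"
| "c (Suc (Suc (Suc (Suc i)))) = 2 * c (Suc (Suc (Suc i))) - c i"

lemma B_examples:
  "B 1 = [L0, L1, L0, L1]"
  "B 2 = [L0, L1, L0, L0, L1, L0]"
  "B 3 = [L0, L1, L0, L0, L1, L0, L1, L1, L0, L0]"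
  "B 4 = [L0, L1, L0, L0, L1, L0, L1, L1, L0, L0, L1, L0, L1, L0, L0, L1, L0, L1]"
  by (simp_all add: inflate_def numeral_eq_Suc)

end

theory Submission
  imports Defs
begin

text \<open>The inflation maps \<open>1 \<mapsto> 10\<close>, \<open>10 \<mapsto> 100\<close> and \<open>100 \<mapsto> 100101\<close>, so it acts as the morphism
  \<open>a \<mapsto> b\<close>, \<open>b \<mapsto> c\<close>, \<open>c \<mapsto> cba\<close> on words factored into \<open>a = 1\<close>, \<open>b = 10\<close>, \<open>c = 100\<close>. The iterates
  \<open>T n\<close> of \<open>a\<close> satisfy a Tribonacci recurrence under concatenation, and \<open>B (n + 1)\<close> is
  \<open>0\<close> followed by \<open>T (n + 1)\<close> and \<open>T n\<close>. The recurrence for \<open>c\<close> follows, since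
  \<open>x^4 - 2x^3 + 1 = (x - 1)(x^3 - x^2 - x - 1)\<close>.\<close>

fun T :: "nat \<Rightarrow> word" where
  "T 0 = [L1]"
| "T (Suc 0) = [L1, L0]"
| "T (Suc (Suc 0)) = [L1, L0, L0]"
| "T (Suc (Suc (Suc n))) = T (Suc (Suc n)) @ T (Suc n) @ T n"

text \<open>A 1 ends any run of 0's before it, so no block straddles the cut.\<close>

lemma blocks_append_L1: "blocks (u @ L1 # v) = blocks u @ blocks (L1 # v)"
  by (induction u rule: blocks.induct)
    (auto simp: takeWhile_append dropWhile_append takeWhile_eq_all_conv[THEN iffD2]
      dropWhile_eq_Nil_conv[THEN iffD2])

lemma inflate_append_L1: "inflate (u @ L1 # v) = inflate u @ inflate (L1 # v)"
  by (simp add: inflate_def blocks_append_L1 del: blocks.simps)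

lemma T_Cons: obtains v where "T n = L1 # v"
proof -
  have "\<exists>v. T n = L1 # v"
    by (induction n rule: T.induct) auto
  then show thesis using that by blast
qed

text \<open>\<open>T n\<close> begins with 1, so a cut in front of it splits no block.\<close>

lemma inflate_append_T: "inflate (u @ T n @ v) = inflate u @ inflate (T n @ v)"
  by (rule T_Cons[of n]) (simp add: inflate_append_L1)

lemma inflate_T: "inflate (T n) = T (Suc n)"
proof (induction n rule: T.induct)
  case (4 n)
  have "inflate (T (Suc (Suc (Suc n)))) =
      inflate (T (Suc (Suc n))) @ inflate (T (Suc n)) @ inflate (T n)"
    using inflate_append_T[of "T (Suc n)" n "[]"] by (simp add: inflate_append_T)
  then show ?case by (simp add: 4)
qed (simp_all add: inflate_def)

lemma B_Suc_eq: "B (Suc n) = L0 # T (Suc n) @ T n"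
proof (induction n)
  case 0
  show ?case by (simp add: inflate_def)
next
  case (Suc n)
  \<comment> \<open>The leading 0 is followed by a 1, hence is a block of its own and stays
    fixed.\<close>
  have "inflate ([L0] @ T (Suc n) @ T n) = inflate [L0] @ inflate (T (Suc n)) @ inflate (T n)"
    using inflate_append_T[of "T (Suc n)" n "[]"] by (simp add: inflate_append_T del: append.simps)
  moreover have "inflate [L0] = [L0]"
    by (simp add: inflate_def)
  ultimately show ?case
    using Suc by (simp add: inflate_T)
qed

lemma c_Suc_eq: "c (Suc n) = 1 + int (length (T (Suc n))) + int (length (T n))"
proof (induction "Suc n" arbitrary: n rule: c.induct)
  case (5 i)
  \<comment> \<open>For \<open>i = 0\<close> the recurrence reaches back to \<open>c 0\<close>,
    which the induction hypothesis does not cover; its value 2 is used directly.\<close>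
  then show ?case by (cases i) auto
qed auto

theorem proposition1:
  fixes i :: nat
  shows "int (length (B i)) = c i"
  by (cases i) (simp_all add: B_Suc_eq c_Suc_eq del: B.simps(2))

end
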